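(* Let $(Y,\mu)$ be a probability space and let $\mathcal{B}\subset L^\infty(Y)$ be a Banach space of functions containing the constants with norm satisfying $|v|_\infty\le\|v\|$. Let $T_j:\mathcal{B}\to\mathcal{B}$, $j\ge0$, be uniformly bounded positive linear operators, let $T(e^{-u})=\sum_{j=0}^\infty T_je^{-uj}$ for $u>0$, and let $P:\mathcal{B}\to\mathcal{B}$ be a bounded linear operator. Suppose that $T(e^{-u})\sim L(1/u)u^{-\beta}P$ as $u\to0^+$, where $\beta\ge0$ and $L$ is slowly varying. Then for all $v\in\mathcal{B}$, $$\lim_{n\to\infty}\Gamma(1+\beta)L(n)^{-1}n^{-\beta}\sum_{j=0}^nT_jv=Pv,$$ uniformly on $Y$.
   Context: For bounded linear operators $A(u),A$ on $\mathcal{B}$ and a positive function $c(u)$, $A(u)\sim c(u)A$ means $\|A(u)-c(u)A\|=o(c(u))$ in the operator norm on $\mathcal{B}$. An operator is positive if it maps nonnegative functions to nonnegative functions. Uniform convergence on $Y$ is modulo null sets (in $L^\infty(Y)$). *)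

theory Defs
  imports "HOL-Probability.Probability" "HOL-Probability.Essential_Supremum" "HOL-Library.Landau_Symbols"
begin

(* Extended-real valued; by the convention of esssup the value is infinity
   if |f| is not measurable. *)
definition Linf_norm :: "'a measure \<Rightarrow> ('a \<Rightarrow> real) \<Rightarrow> ereal" where
  "Linf_norm M f = esssup M (\<lambda>y. ereal \<bar>f y\<bar>)"

(* A real Banach space B contained in L^infinity(M) over a probability space M.  Elements of
   L^infinity(M) are classes of functions modulo null sets and the classes depend on M, so B is
   given as a Banach space type 'b (with its own norm) together with a map rep choosing a
   representative of each element.  The inclusion of B into L^infinity(M) is thus linear and
   injective modulo null sets only. *)
locale Linf_banach_space = prob_space M
  for M :: "'a measure" and rep :: "'b::banach \<Rightarrow> 'a \<Rightarrow> real" +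
  assumes rep_measurable: "rep v \<in> borel_measurable M"
    and rep_add: "AE y in M. rep (v + w) y = rep v y + rep w y"
    and rep_scaleR: "AE y in M. rep (c *\<^sub>R v) y = c * rep v y"
    and rep_inject: "(AE y in M. rep v y = rep w y) \<Longrightarrow> v = w"
    and constants: "\<exists>v. AE y in M. rep v y = c"
    and Linf_norm_le: "Linf_norm M (rep v) \<le> ereal (norm v)"

definition positive_operator ::
    "'a measure \<Rightarrow> ('b::real_normed_vector \<Rightarrow> 'a \<Rightarrow> real) \<Rightarrow> ('b \<Rightarrow>\<^sub>L 'b) \<Rightarrow> bool" where
  "positive_operator M rep A \<longleftrightarrow>
     (\<forall>v. (AE y in M. 0 \<le> rep v y) \<longrightarrow> (AE y in M. 0 \<le> rep (blinfun_apply A v) y))"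

(* A(u) ~ c(u) A along the filter F, in operator norm (the norm of the type of bounded
   linear operators). *)
definition operator_asymp ::
    "real filter \<Rightarrow> (real \<Rightarrow> 'b::real_normed_vector \<Rightarrow>\<^sub>L 'b) \<Rightarrow> (real \<Rightarrow> real) \<Rightarrow> ('b \<Rightarrow>\<^sub>L 'b) \<Rightarrow> bool" where
  "operator_asymp F A c P \<longleftrightarrow> (\<lambda>u. norm (A u - c u *\<^sub>R P)) \<in> o[F](c)"

(* Slow variation at infinity: L need only be positive and (Lebesgue) measurable on some
   neighbourhood of infinity; its other values are irrelevant. *)
definition slowly_varying :: "(real \<Rightarrow> real) \<Rightarrow> bool" where
  "slowly_varying L \<longleftrightarrow>
     (\<exists>a. L \<in> borel_measurable (lebesgue_on {a..}) \<and> (\<forall>x\<ge>a. L x > 0)) \<and>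
     (\<forall>t>0. ((\<lambda>x. L (t * x) / L x) \<longlongrightarrow> 1) at_top)"

end

theory Submission
  imports Defs "HOL-Real_Asymp.Real_Asymp"
begin

text \<open>
  Karamata's argument, carried out in the order of \<open>L\<^sup>\<infinity>\<close>. Put \<open>x\<^sub>j = exp (- j / n)\<close> and
  \<open>C\<^sub>n = L(n) n\<^sup>\<beta>\<close>. By the hypothesis at \<open>u = (i + 1) / n\<close> and slow variation,
  \<open>\<Sum>\<^sub>j x\<^sub>j\<^bsup>i+1\<^esup> T\<^sub>j v / C\<^sub>n\<close> converges in norm to \<open>(i + 1)\<^bsup>-\<beta>\<^esup> P v\<close>, and
  \<open>(i + 1)\<^bsup>-\<beta>\<^esup>\<close> is the \<open>i\<close>-th moment of \<open>exp (- t)\<close> when \<open>t\<close> is Gamma distributed with parameter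
  \<open>\<beta>\<close>. So \<open>\<Sum>\<^sub>j x\<^sub>j p(x\<^sub>j) T\<^sub>j v / C\<^sub>n\<close> converges to \<open>E p(exp (- t)) P v\<close> for every polynomial \<open>p\<close>.
  The partial sum is the case of the discontinuous \<open>p(x) = 1 / x\<close> for \<open>x \<ge> 1 / e\<close>, and \<open>0\<close> otherwise;
  this is squeezed between polynomials whose expectations differ by little, which for \<open>v \<ge> 0\<close>
  and positive \<open>T\<^sub>j\<close> gives two-sided bounds almost everywhere, with an error independent of the point.
  A general \<open>v\<close> is the difference of two nonnegative elements because \<open>B\<close> contains the constants.
\<close>

section \<open>The Gamma distribution and the cutoff\<close>

text \<open>The factor \<open>x\<close> is split off from the indicator of
  \<open>x \<ge> exp (-1)\<close> because the hypothesis controls only positive exponents: the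
  unweighted series over \<open>T j\<close> may diverge.\<close>

definition cutoff :: "real \<Rightarrow> real" where
  "cutoff x = (if x \<ge> exp (-1) then 1 / x else 0)"

lemma cutoff_measurable [measurable]: "cutoff \<in> borel_measurable borel"
  unfolding cutoff_def by measurable

text \<open>Substitution of \<open>c * t\<close> in the Gamma integral. The value
  \<open>c = 1\<close> normalizes the density and \<open>c = k + 1\<close> gives the
  \<open>k\<close>-th moment of \<open>exp (- t)\<close>.\<close>

lemma Gamma_weight_moments:
  fixes \<beta> :: real
  assumes "\<beta> > 0" "c > 0"
  shows "has_bochner_integral lborel (\<lambda>t. indicator {0..} t * t powr (\<beta> - 1) * exp (- (c * t)))
           (Gamma \<beta> * c powr (- \<beta>))"
proof -
  let ?h = "\<lambda>t. indicator {0..} t * t powr (\<beta> - 1) / exp t :: real"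
  have *: "has_bochner_integral lborel ?h (Gamma \<beta>)"
  proof (rule has_bochner_integral_nn_integral)
    show "integral\<^sup>N lborel ?h = ennreal (Gamma \<beta>)"
      using Gamma_conv_nn_integral_real[OF assms(1)] by simp
  qed (use Gamma_real_pos[OF assms(1)] in auto)
  have "has_bochner_integral lborel (\<lambda>t. ?h (0 + c * t)) (Gamma \<beta> /\<^sub>R \<bar>c\<bar>)"
    using * assms(2) by (subst lborel_has_bochner_integral_real_affine_iff[symmetric]) auto
  \<comment> \<open>This factor cancels the \<open>c powr (\<beta> - 1)\<close> that the
    substitution draws out of the power of \<open>c * t\<close>.\<close>
  from has_bochner_integral_mult_right[OF this, of "c powr (1 - \<beta>)"]
  have "has_bochner_integral lborel (\<lambda>t. c powr (1 - \<beta>) * ?h (0 + c * t))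
          (c powr (1 - \<beta>) * (Gamma \<beta> /\<^sub>R \<bar>c\<bar>))" .
  moreover have "c powr (1 - \<beta>) * (Gamma \<beta> /\<^sub>R \<bar>c\<bar>) = Gamma \<beta> * c powr (- \<beta>)"
    using assms(2) by (simp add: powr_diff powr_minus field_simps)
  moreover have "c powr (1 - \<beta>) * ?h (0 + c * t)
      = indicator {0..} t * t powr (\<beta> - 1) * exp (- (c * t))" for t
  proof (cases "t \<ge> 0")
    case True
    then have "(c * t) powr (\<beta> - 1) = c powr (\<beta> - 1) * t powr (\<beta> - 1)"
      using assms(2) by (simp add: powr_mult)
    moreover have "c powr (1 - \<beta>) * c powr (\<beta> - 1) = 1"
      using assms(2) by (simp flip: powr_add)
    ultimately show ?thesis
      using True assms(2) by (simp add: exp_minus divide_inverse zero_le_mult_iff)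
  qed (use assms(2) in \<open>auto simp: indicator_def zero_le_mult_iff\<close>)
  ultimately show ?thesis by (simp only:)
qed

text \<open>For \<open>t \<ge> 0\<close> the product \<open>exp (- t) * cutoff (exp (- t))\<close>
  is the indicator of \<open>t \<le> 1\<close>, so only the integral of a power over the unit
  interval remains. Divided by \<open>Gamma \<beta>\<close> it becomes the constant
  \<open>1 / Gamma (1 + \<beta>)\<close> of the theorem.\<close>

lemma Gamma_weight_cutoff:
  fixes \<beta> :: real
  assumes "\<beta> > 0"
  shows "has_bochner_integral lborel
           (\<lambda>t. indicator {0..} t * t powr (\<beta> - 1) * exp (- t) * cutoff (exp (- t))) (1 / \<beta>)"
proof -
  have "((\<lambda>t. t powr (\<beta> - 1)) has_integral (1 / \<beta>)) {0..1}"
    using has_integral_powr_from_0[of "\<beta> - 1" 1] assms by simp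
  then have "((\<lambda>t. indicator {0..1} t * t powr (\<beta> - 1)) has_integral (1 / \<beta>)) UNIV"
    by (subst (asm) has_integral_restrict_UNIV[symmetric])
      (auto simp: indicator_def elim!: has_integral_eq[rotated])
  then have "integral\<^sup>N lborel (\<lambda>t. indicator {0..1} t * t powr (\<beta> - 1)) = ennreal (1 / \<beta>)"
    by (intro nn_integral_has_integral_lborel) auto
  then have "has_bochner_integral lborel (\<lambda>t. indicator {0..1} t * t powr (\<beta> - 1)) (1 / \<beta>)"
    using assms by (intro has_bochner_integral_nn_integral) auto
  moreover have "indicator {0..} t * t powr (\<beta> - 1) * exp (- t) * cutoff (exp (- t))
     = indicator {0..1} t * t powr (\<beta> - 1)" for t :: real
    by (auto simp: indicator_def cutoff_def)
  ultimately show ?thesis by (simp only:)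
qed

text \<open>For \<open>\<beta> = 0\<close> the Gamma distribution degenerates to the point mass at 0.\<close>

lemma Gamma_distribution_exists:
  fixes \<beta> :: real
  assumes "\<beta> \<ge> 0"
  obtains N :: "real measure" where "prob_space N" "sets N = sets borel"
    "AE t in N. 0 \<le> t" "AE t in N. t \<noteq> 1"
    "\<And>k::nat. integral\<^sup>L N (\<lambda>t. exp (- t) ^ k) = real (k + 1) powr (- \<beta>)"
    "integral\<^sup>L N (\<lambda>t. cutoff (exp (- t))) = 1 / Gamma (1 + \<beta>)"
proof (cases "\<beta> = 0")
  case True
  show thesis
  proof (rule that[of "return borel 0"])
    show "prob_space (return borel (0::real))"
      by (rule prob_space_return) simp
  qed (auto simp: AE_return integral_return True cutoff_def)
next
  case False
  with assms have \<beta>: "\<beta> > 0" by simp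
  then have G: "Gamma \<beta> > 0" by (rule Gamma_real_pos)
  define w where "w t = indicator {0..} t * t powr (\<beta> - 1) * exp (- t) / Gamma \<beta>" for t :: real
  have w_meas [measurable]: "w \<in> borel_measurable borel"
    unfolding w_def by measurable
  have w_nonneg: "w t \<ge> 0" for t
    using G by (simp add: w_def)
  let ?N = "density lborel w"
  have integral_w: "integral\<^sup>L ?N f = integral\<^sup>L lborel (\<lambda>t. w t * f t)"
    if "f \<in> borel_measurable borel" for f :: "real \<Rightarrow> real"
    using that by (subst integral_density) (auto simp: w_nonneg)
  show thesis
  proof (rule that[of ?N])
    have "has_bochner_integral lborel w 1"
      using has_bochner_integral_divide[OF Gamma_weight_moments[OF \<beta>, of 1], of "Gamma \<beta>"] G
      by (simp add: w_def[abs_def])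
    then have "integral\<^sup>N lborel w = 1"
      using nn_integral_eq_integral[of lborel w] w_nonneg by (auto simp: has_bochner_integral_iff)
    then show "prob_space ?N"
      by (intro prob_spaceI) (simp add: emeasure_density)
    show "AE t in ?N. 0 \<le> t"
      by (subst AE_density) (auto simp: w_def indicator_def)
    \<comment> \<open>At \<open>t = 1\<close> the point \<open>exp (- t)\<close> meets the jump of
      the cutoff, the only place where continuous approximations can fail to converge.\<close>
    have "AE t in lborel. t \<noteq> (1::real)"
      by (rule AE_lborel_singleton)
    then show "AE t in ?N. t \<noteq> 1"
      by (subst AE_density) auto
    show "integral\<^sup>L ?N (\<lambda>t. exp (- t) ^ k) = real (k + 1) powr (- \<beta>)" for k :: nat
    proof -
      \<comment> \<open>The density already carries one factor \<open>exp (- t)\<close>, hence the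
        shift from \<open>k\<close> to \<open>k + 1\<close>.\<close>
      have "w t * exp (- t) ^ k
          = indicator {0..} t * t powr (\<beta> - 1) * exp (- (real (k + 1) * t)) / Gamma \<beta>" for t
      proof -
        have "exp (- (real (k + 1) * t)) = exp (- t) * exp (- t) ^ k"
          by (simp add: exp_of_nat_mult[symmetric] mult_exp_exp algebra_simps)
        then show ?thesis by (simp add: w_def)
      qed
      then show ?thesis
        using has_bochner_integral_divide[OF Gamma_weight_moments[OF \<beta>, of "real (k + 1)"], of "Gamma \<beta>"] G
        by (subst integral_w) (auto simp: has_bochner_integral_iff)
    qed
    have "w t * cutoff (exp (- t))
        = indicator {0..} t * t powr (\<beta> - 1) * exp (- t) * cutoff (exp (- t)) / Gamma \<beta>" for t
      by (simp add: w_def)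
    moreover have "Gamma (1 + \<beta>) = \<beta> * Gamma \<beta>"
      using Gamma_plus1[of \<beta>] \<beta> by (auto simp: add.commute nonpos_Ints_def)
    ultimately show "integral\<^sup>L ?N (\<lambda>t. cutoff (exp (- t))) = 1 / Gamma (1 + \<beta>)"
      using has_bochner_integral_divide[OF Gamma_weight_cutoff[OF \<beta>], of "Gamma \<beta>"] G
      by (subst integral_w) (auto simp: has_bochner_integral_iff)
  qed simp
qed

section \<open>Polynomial approximation from above\<close>

text \<open>By dominated convergence some continuous majorant \<open>h m\<close> has nearly the
  integral of \<open>g\<close>, and a Weierstrass approximation of a slightly raised
  \<open>h m\<close> is a polynomial majorant. The interval from 0 to 1 suffices, as
  \<open>exp (- t)\<close> lies there for \<open>t \<ge> 0\<close>.\<close>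

lemma one_sided_polynomial_approximation:
  fixes g :: "real \<Rightarrow> real" and h :: "nat \<Rightarrow> real \<Rightarrow> real"
  assumes N: "prob_space N" "sets N = sets borel" "AE t in N. 0 \<le> t"
    and h_cont: "\<And>m. continuous_on {0..1} (h m)"
    and h_bound: "\<And>m x. \<bar>h m x\<bar> \<le> B"
    and h_meas [measurable]: "\<And>m. h m \<in> borel_measurable borel"
    and g_meas [measurable]: "g \<in> borel_measurable borel"
    and g_le: "\<And>m x. x \<in> {0..1} \<Longrightarrow> g x \<le> h m x"
    and h_lim: "AE t in N. (\<lambda>m. h m (exp (- t))) \<longlonglongrightarrow> g (exp (- t))"
    and \<epsilon>: "\<epsilon> > 0"
  obtains a n where "\<And>x. x \<in> {0..1} \<Longrightarrow> g x \<le> (\<Sum>i\<le>n. a i * x ^ i)"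
    "(\<Sum>i\<le>n. a i * integral\<^sup>L N (\<lambda>t. exp (- t) ^ i)) \<le> integral\<^sup>L N (\<lambda>t. g (exp (- t))) + \<epsilon>"
proof -
  interpret prob_space N by fact
  note [measurable_cong] = N(2)
  have "(\<lambda>m. integral\<^sup>L N (\<lambda>t. h m (exp (- t)))) \<longlonglongrightarrow> integral\<^sup>L N (\<lambda>t. g (exp (- t)))"
    using h_lim h_bound by (intro integral_dominated_convergence[where w = "\<lambda>_. B"]) auto
  then have "eventually (\<lambda>m. integral\<^sup>L N (\<lambda>t. h m (exp (- t))) < integral\<^sup>L N (\<lambda>t. g (exp (- t))) + \<epsilon> / 3)
      sequentially"
    using \<epsilon> by (intro order_tendstoD(2)) auto
  then obtain m where m: "integral\<^sup>L N (\<lambda>t. h m (exp (- t))) < integral\<^sup>L N (\<lambda>t. g (exp (- t))) + \<epsilon> / 3"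
    by (auto simp: eventually_sequentially)
  \<comment> \<open>Raising \<open>h m\<close> by the approximation error keeps \<open>q\<close>
    between \<open>h m\<close> and \<open>h m + 2 * \<epsilon> / 3\<close>.\<close>
  obtain q where "real_polynomial_function q"
    and q: "\<And>x. x \<in> {0..1} \<Longrightarrow> \<bar>(h m x + \<epsilon> / 3) - q x\<bar> < \<epsilon> / 3"
  proof (rule Stone_Weierstrass_real_polynomial_function[where e = "\<epsilon> / 3"])
    show "continuous_on {0..1} (\<lambda>x. h m x + \<epsilon> / 3)"
      by (intro continuous_intros h_cont)
  qed (use \<epsilon> in auto)
  then obtain a n where a: "q = (\<lambda>x. \<Sum>i\<le>n. a i * x ^ i)"
    by (auto simp: real_polynomial_function_iff_sum)
  have int_h: "integrable N (\<lambda>t. h m (exp (- t)))"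
    using h_bound by (intro integrable_const_bound[where B = B]) auto
  have int_pow: "integrable N (\<lambda>t. exp (- t) ^ i)" for i :: nat
    using N(3) by (intro integrable_const_bound[where B = 1]) (auto intro!: power_le_one)
  have "(\<Sum>i\<le>n. a i * integral\<^sup>L N (\<lambda>t. exp (- t) ^ i)) = integral\<^sup>L N (\<lambda>t. q (exp (- t)))"
    unfolding a by (simp add: Bochner_Integration.integral_sum int_pow)
  also have "\<dots> \<le> integral\<^sup>L N (\<lambda>t. h m (exp (- t)) + 2 * \<epsilon> / 3)"
  proof (rule integral_mono_AE)
    show "integrable N (\<lambda>t. q (exp (- t)))"
      unfolding a by (intro Bochner_Integration.integrable_sum integrable_mult_right int_pow)
    show "AE t in N. q (exp (- t)) \<le> h m (exp (- t)) + 2 * \<epsilon> / 3"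
      using N(3)
    proof eventually_elim
      case (elim t)
      then have "exp (- t) \<in> {0..1}" by simp
      from q[OF this] show ?case unfolding abs_less_iff by linarith
    qed
  qed (use int_h in auto)
  also have "\<dots> = integral\<^sup>L N (\<lambda>t. h m (exp (- t))) + 2 * \<epsilon> / 3"
    using int_h by (simp add: prob_space)
  also have "\<dots> \<le> integral\<^sup>L N (\<lambda>t. g (exp (- t))) + \<epsilon>"
    using m by simp
  finally show thesis
  proof (rule that[rotated])
    fix x :: real assume x: "x \<in> {0..1}"
    show "g x \<le> (\<Sum>i\<le>n. a i * x ^ i)"
      using q[OF x] g_le[OF x, of m] unfolding a abs_less_iff by linarith
  qed
qed

text \<open>With \<open>s = -1\<close> the negated polynomial lies below the cutoff, so one
  statement serves both sides of the squeeze.\<close>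

lemma cutoff_polynomial_approximation:
  fixes \<beta> s :: real
  assumes "\<beta> \<ge> 0" "s \<in> {1, -1}" "\<epsilon> > 0"
  obtains a n where "\<And>x. x \<in> {0..1} \<Longrightarrow> s * cutoff x \<le> (\<Sum>i\<le>n. a i * x ^ i)"
    "(\<Sum>i\<le>n. a i * real (i + 1) powr (- \<beta>)) \<le> s / Gamma (1 + \<beta>) + \<epsilon>"
proof -
  obtain N :: "real measure" where N: "prob_space N" "sets N = sets borel"
    "AE t in N. 0 \<le> t" "AE t in N. t \<noteq> 1"
    and moments: "\<And>k::nat. integral\<^sup>L N (\<lambda>t. exp (- t) ^ k) = real (k + 1) powr (- \<beta>)"
    and int_cutoff: "integral\<^sup>L N (\<lambda>t. cutoff (exp (- t))) = 1 / Gamma (1 + \<beta>)"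
    using Gamma_distribution_exists[OF assms(1)] by blast
  \<comment> \<open>The jump of the cutoff at \<open>exp (- 1)\<close> is replaced by a ramp of slope \<open>m\<close>, to its left if
    \<open>s = 1\<close> and to its right if \<open>s = - 1\<close>, so that \<open>s * cutoff\<close> is bounded from above in both cases.\<close>
  define k where "k x = 1 / max x (exp (-1))" for x :: real
  define \<psi> where "\<psi> m x = max 0 (min 1 ((if s = 1 then 1 else 0) + real m * (x - exp (-1))))" for m x
  define h where "h m x = s * k x * \<psi> m x" for m x
  have k_bounds: "0 \<le> k x" "k x \<le> exp 1" for x
  proof -
    have "max x (exp (-1)) \<ge> exp (-1)" by simp
    moreover have "exp (-1) > (0::real)" by simp
    ultimately show "0 \<le> k x" "k x \<le> exp 1"
      using frac_le[of 1 1 "exp (-1)" "max x (exp (-1))"]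
      by (auto simp: k_def exp_minus inverse_eq_divide le_max_iff_disj simp del: exp_gt_zero)
  qed
  \<comment> \<open>The floor in \<open>k\<close> takes effect only where the step vanishes. Thus
    \<open>k\<close> is a continuous bounded factor, and only the step has to be smoothed.\<close>
  have cutoff_k: "cutoff x = k x * (if x \<ge> exp (-1) then 1 else 0)" for x
    by (auto simp: cutoff_def k_def)
  have \<psi>_bounds: "0 \<le> \<psi> m x" "\<psi> m x \<le> 1" for m x
    by (auto simp: \<psi>_def)
  have k_cont: "continuous_on UNIV k"
    unfolding k_def by (intro continuous_intros) (auto simp: max_def not_le)
  have \<psi>_cont: "continuous_on UNIV (\<psi> m)" for m
    unfolding \<psi>_def by (intro continuous_intros)
  have h_cont: "continuous_on UNIV (h m)" for m
    unfolding h_def by (intro continuous_intros k_cont \<psi>_cont)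
  obtain a n where "\<And>x. x \<in> {0..1} \<Longrightarrow> s * cutoff x \<le> (\<Sum>i\<le>n. a i * x ^ i)"
    "(\<Sum>i\<le>n. a i * integral\<^sup>L N (\<lambda>t. exp (- t) ^ i)) \<le> integral\<^sup>L N (\<lambda>t. s * cutoff (exp (- t))) + \<epsilon>"
  proof (rule one_sided_polynomial_approximation[OF N(1-3), of h "exp 1" "\<lambda>x. s * cutoff x" \<epsilon>])
    show "continuous_on {0..1} (h m)" for m
      using h_cont continuous_on_subset by blast
    show "h m \<in> borel_measurable borel" for m
      using h_cont by (rule borel_measurable_continuous_onI)
    show "\<bar>h m x\<bar> \<le> exp 1" for m x
      using assms(2) mult_mono[OF k_bounds(2)[of x] \<psi>_bounds(2)[of m x]] k_bounds \<psi>_bounds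
      by (auto simp: h_def abs_mult)
    show "s * cutoff x \<le> h m x" for m x
    proof -
      have "s * (if x \<ge> exp (-1) then 1 else 0) \<le> s * \<psi> m x"
      proof (cases "x \<ge> exp (-1)")
        case True
        then have "real m * (x - exp (-1)) \<ge> 0" by simp
        then show ?thesis using assms(2) True by (auto simp: \<psi>_def)
      next
        case False
        then have "real m * (x - exp (-1)) \<le> 0" by (simp add: mult_nonneg_nonpos)
        then show ?thesis using assms(2) False by (auto simp: \<psi>_def)
      qed
      from mult_left_mono[OF this k_bounds(1)[of x]] show ?thesis
        by (simp add: cutoff_k h_def mult_ac)
    qed
    show "AE t in N. (\<lambda>m. h m (exp (- t))) \<longlonglongrightarrow> s * cutoff (exp (- t))"
      using N(4)
    proof eventually_elim
      case (elim t)
      define x where "x = exp (- t)"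
      \<comment> \<open>At the jump the ramp for \<open>s = -1\<close> is 0 for every
        \<open>m\<close>, whereas the step is 1.\<close>
      have "x \<noteq> exp (-1)" using elim by (simp add: x_def)
      have "(\<lambda>m. \<psi> m x) \<longlonglongrightarrow> (if x \<ge> exp (-1) then 1 else 0)"
      proof (cases "x > exp (-1)")
        case True
        then have "eventually (\<lambda>m. 1 \<le> real m * (x - exp (-1))) sequentially"
          by real_asymp
        then have "eventually (\<lambda>m. \<psi> m x = 1) sequentially"
          by eventually_elim (auto simp: \<psi>_def)
        then show ?thesis using True by (simp add: tendsto_eventually)
      next
        case False
        with \<open>x \<noteq> _\<close> have "x < exp (-1)" by simp
        \<comment> \<open>The bound -1 also absorbs the offset 1 that the ramp has for
          \<open>s = 1\<close>.\<close>
        then have "eventually (\<lambda>m. real m * (x - exp (-1)) \<le> -1) sequentially"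
          by real_asymp
        then have "eventually (\<lambda>m. \<psi> m x = 0) sequentially"
          by eventually_elim (auto simp: \<psi>_def)
        then show ?thesis using \<open>x < _\<close> by (simp add: tendsto_eventually)
      qed
      then have "(\<lambda>m. h m x) \<longlonglongrightarrow> s * k x * (if x \<ge> exp (-1) then 1 else 0)"
        unfolding h_def by (intro tendsto_intros)
      then show ?case by (simp add: cutoff_k x_def mult.assoc)
    qed
  qed (use assms(3) in auto)
  then show thesis
    by (intro that[of a n]) (simp_all add: moments int_cutoff)
qed

section \<open>Laplace sums and their rescaled limits\<close>

lemma laplace_sums:
  fixes T :: "nat \<Rightarrow> 'b::banach"
  assumes "bounded (range T)" "u > 0"
  shows "(\<lambda>j. exp (- (u * real j)) *\<^sub>R T j) sums (\<Sum>j. exp (- (u * real j)) *\<^sub>R T j)"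
proof -
  obtain B where B: "\<And>j. norm (T j) \<le> B"
    using assms(1) by (auto simp: bounded_iff)
  have "summable (\<lambda>j. exp (- u) ^ j * B)"
    using assms(2) by (intro summable_mult2 summable_geometric) auto
  then have "summable (\<lambda>j. exp (- (u * real j)) *\<^sub>R T j)"
  proof (rule summable_comparison_test'[where N = 0])
    fix j :: nat
    have "exp (- u) ^ j = exp (- (u * real j))"
      by (simp add: exp_of_nat_mult[symmetric] mult.commute)
    then show "norm (exp (- (u * real j)) *\<^sub>R T j) \<le> exp (- u) ^ j * B"
      using B[of j] by simp
  qed
  then show ?thesis by (rule summable_sums)
qed

lemma slowly_varying_eventually_pos:
  assumes "slowly_varying L"
  shows "eventually (\<lambda>x. L x > 0) at_top"
  using assms unfolding slowly_varying_def by (auto simp: eventually_at_top_linorder)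

text \<open>At \<open>u = t / n\<close> the comparison function contains \<open>L (n / t)\<close>,
  which slow variation lets \<open>L n\<close> replace. The powers of \<open>n\<close> cancel and
  leave \<open>t powr (- \<beta>)\<close>.\<close>

lemma operator_asymp_rescaled:
  fixes F :: "real \<Rightarrow> 'b::real_normed_vector \<Rightarrow>\<^sub>L 'b"
  assumes L: "slowly_varying L"
    and asymp: "operator_asymp (at_right 0) F (\<lambda>u. L (1 / u) * u powr (- \<beta>)) P"
    and t: "t > 0"
  shows "(\<lambda>n. (inverse (L (real n)) * real n powr (- \<beta>)) *\<^sub>R F (t / real n))
           \<longlonglongrightarrow> t powr (- \<beta>) *\<^sub>R P"
proof -
  define c where "c u = L (1 / u) * u powr (- \<beta>)" for u
  define K where "K n = inverse (L (real n)) * real n powr (- \<beta>)" for n :: nat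
  have u_lim: "filterlim (\<lambda>n. t / real n) (at_right 0) sequentially"
    using t by real_asymp
  have inv_u_lim: "filterlim (\<lambda>n. real n / t) at_top sequentially"
    using t by real_asymp
  have "(\<lambda>u. norm (F u - c u *\<^sub>R P)) \<in> o[at_right 0](c)"
    using asymp unfolding operator_asymp_def c_def .
  then have "((\<lambda>u. norm (F u - c u *\<^sub>R P) / c u) \<longlongrightarrow> 0) (at_right 0)"
    by (rule smalloD_tendsto)
  then have err: "(\<lambda>n. norm (F (t / real n) - c (t / real n) *\<^sub>R P) / c (t / real n)) \<longlonglongrightarrow> 0"
    by (rule filterlim_compose[OF _ u_lim])
  have "1 / t > 0" using t by simp
  then have "((\<lambda>x. L (1 / t * x) / L x) \<longlongrightarrow> 1) at_top"
    using L unfolding slowly_varying_def by blast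
  from filterlim_compose[OF this filterlim_real_sequentially]
  have "(\<lambda>n. L (real n / t) / L (real n) * t powr (- \<beta>)) \<longlonglongrightarrow> 1 * t powr (- \<beta>)"
    by (intro tendsto_mult_right) simp
  moreover have "eventually (\<lambda>n. L (real n / t) / L (real n) * t powr (- \<beta>) = K n * c (t / real n)) sequentially"
    using eventually_gt_at_top[of 0]
  proof eventually_elim
    case (elim n)
    then have "(t / real n) powr (- \<beta>) * real n powr (- \<beta>) = t powr (- \<beta>)"
      using t by (simp flip: powr_mult)
    then show ?case
      by (simp add: K_def c_def divide_inverse mult_ac)
  qed
  ultimately have Kc: "(\<lambda>n. K n * c (t / real n)) \<longlonglongrightarrow> t powr (- \<beta>)"
    by (simp add: tendsto_cong)
  have "eventually (\<lambda>n. L (real n / t) > 0) sequentially"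
    using slowly_varying_eventually_pos[OF L] inv_u_lim by (rule eventually_compose_filterlim)
  \<comment> \<open>Division by 0 yields 0, so the quotient \<open>err\<close> measures the error
    only where \<open>c\<close> is nonzero.\<close>
  then have c_nz: "eventually (\<lambda>n. c (t / real n) \<noteq> 0) sequentially"
    using eventually_gt_at_top[of 0] by eventually_elim (use t in \<open>auto simp: c_def\<close>)
  have "(\<lambda>n. \<bar>K n * c (t / real n)\<bar> * \<bar>norm (F (t / real n) - c (t / real n) *\<^sub>R P) / c (t / real n)\<bar>) \<longlonglongrightarrow>
      \<bar>t powr (- \<beta>)\<bar> * \<bar>0\<bar>"
    by (intro tendsto_intros Kc err)
  moreover have "eventually (\<lambda>n. \<bar>K n * c (t / real n)\<bar> * \<bar>norm (F (t / real n) - c (t / real n) *\<^sub>R P) / c (t / real n)\<bar>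
      = norm (K n *\<^sub>R F (t / real n) - (K n * c (t / real n)) *\<^sub>R P)) sequentially"
    using c_nz
  proof eventually_elim
    case (elim n)
    have "K n *\<^sub>R F (t / real n) - (K n * c (t / real n)) *\<^sub>R P
        = K n *\<^sub>R (F (t / real n) - c (t / real n) *\<^sub>R P)"
      by (simp add: scaleR_diff_right)
    then show ?case using elim by (simp add: abs_mult)
  qed
  ultimately have "(\<lambda>n. norm (K n *\<^sub>R F (t / real n) - (K n * c (t / real n)) *\<^sub>R P)) \<longlonglongrightarrow> 0"
    by (simp add: tendsto_cong)
  then have "(\<lambda>n. K n *\<^sub>R F (t / real n) - (K n * c (t / real n)) *\<^sub>R P) \<longlonglongrightarrow> 0"
    by (rule tendsto_norm_zero_cancel)
  from tendsto_add[OF this tendsto_scaleR[OF Kc tendsto_const[of P]]]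
  show ?thesis by (simp add: K_def)
qed

section \<open>The cone of almost everywhere nonnegative elements\<close>

context Linf_banach_space
begin

lemma AE_rep_zero: "AE y in M. rep 0 y = 0"
  using rep_scaleR[of 0 0] by simp

lemma AE_rep_diff: "AE y in M. rep (v - w) y = rep v y - rep w y"
  using rep_add[of v "- w"] rep_scaleR[of "-1" w] by eventually_elim simp

lemma AE_rep_sum:
  "finite A \<Longrightarrow> AE y in M. rep (\<Sum>i\<in>A. f i) y = (\<Sum>i\<in>A. rep (f i) y)"
proof (induction rule: finite_induct)
  case (insert i A)
  show ?case
    using insert.IH rep_add[of "f i" "\<Sum>i\<in>A. f i"] by eventually_elim (use insert.hyps in simp)
qed (use AE_rep_zero in simp)

text \<open>This turns convergence in the norm of the Banach space into pointwise bounds with an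
  error independent of the point.\<close>

lemma AE_abs_rep_le: "AE y in M. \<bar>rep v y\<bar> \<le> norm v"
proof -
  have "AE y in M. ereal \<bar>rep v y\<bar> \<le> Linf_norm M (rep v)"
    unfolding Linf_norm_def by (rule esssup_AE)
  then show ?thesis
    by eventually_elim (use Linf_norm_le[of v] in \<open>auto dest: order_trans\<close>)
qed

abbreviation nonneg :: "'b \<Rightarrow> bool" where
  "nonneg v \<equiv> AE y in M. 0 \<le> rep v y"

lemma nonneg_scaleR: "0 \<le> c \<Longrightarrow> nonneg v \<Longrightarrow> nonneg (c *\<^sub>R v)"
  using rep_scaleR[of c v] by (auto elim: eventually_elim2)

lemma nonneg_sum:
  assumes "finite A" "\<And>i. i \<in> A \<Longrightarrow> nonneg (f i)"
  shows "nonneg (\<Sum>i\<in>A. f i)"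
proof -
  have "AE y in M. \<forall>i\<in>A. 0 \<le> rep (f i) y"
    using assms by (simp add: AE_finite_all)
  with AE_rep_sum[OF assms(1), of f] show ?thesis
    by eventually_elim (simp add: sum_nonneg)
qed

text \<open>Outside one null set, the union of countably many, \<open>rep v y\<close> is at least
  \<open>- norm (v - f n)\<close> for all large \<open>n\<close>, and this bound tends to 0.\<close>

lemma nonneg_limit:
  assumes "f \<longlonglongrightarrow> v" "eventually (\<lambda>n. nonneg (f n)) sequentially"
  shows "nonneg v"
proof -
  obtain n0 where n0: "\<And>n. n \<ge> n0 \<Longrightarrow> nonneg (f n)"
    using assms(2) by (auto simp: eventually_sequentially)
  have "AE y in M. n \<ge> n0 \<longrightarrow> - norm (v - f n) \<le> rep v y" for n
  proof (cases "n \<ge> n0")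
    case True
    show ?thesis
      using n0[OF True] AE_rep_diff[of v "f n"] AE_abs_rep_le[of "v - f n"]
      by eventually_elim linarith
  qed simp
  then have "AE y in M. \<forall>n. n \<ge> n0 \<longrightarrow> - norm (v - f n) \<le> rep v y"
    by (simp add: AE_all_countable)
  then show ?thesis
  proof eventually_elim
    case (elim y)
    have "(\<lambda>n. - norm (v - f n)) \<longlonglongrightarrow> - norm (v - v)"
      by (intro tendsto_intros assms(1))
    then show ?case
      using elim by (intro tendsto_upperbound[of _ 0 sequentially]) (auto simp: eventually_sequentially)
  qed
qed

lemma nonneg_sums:
  assumes "f sums v" "\<And>j. nonneg (f j)"
  shows "nonneg v"
proof (rule nonneg_limit)
  show "(\<lambda>n. sum f {..<n}) \<longlonglongrightarrow> v"
    using assms(1) by (simp add: sums_def)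
  have "nonneg (sum f {..<n})" for n
    using assms(2) by (intro nonneg_sum) auto
  then show "eventually (\<lambda>n. nonneg (sum f {..<n})) sequentially"
    by simp
qed

section \<open>Karamata's comparison\<close>

text \<open>Written as one series, the difference has terms \<open>T j v\<close> with coefficients
  \<open>x j\<close> times the gap between polynomial and cutoff. These coefficients are
  nonnegative, and so is each \<open>T j v\<close>.\<close>

lemma partial_sum_le_laplace:
  fixes T :: "nat \<Rightarrow> 'b \<Rightarrow>\<^sub>L 'b"
  assumes bnd: "bounded (range T)" and pos: "\<And>j. positive_operator M rep (T j)"
    and v: "nonneg v" and n: "n > 0"
    and p: "\<And>x. x \<in> {0..1} \<Longrightarrow> s * cutoff x \<le> (\<Sum>i\<le>d. a i * x ^ i)"
  shows "nonneg ((\<Sum>i\<le>d. a i *\<^sub>R (\<Sum>j. exp (- (real (i + 1) / real n * real j)) *\<^sub>R T j) v)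
            - s *\<^sub>R (\<Sum>j=0..n. T j v))"
proof (rule nonneg_sums)
  define x where "x j = exp (- (real j / real n))" for j
  have "(\<lambda>j. \<Sum>i\<le>d. a i *\<^sub>R (exp (- (real (i + 1) / real n * real j)) *\<^sub>R T j) v) sums
      (\<Sum>i\<le>d. a i *\<^sub>R (\<Sum>j. exp (- (real (i + 1) / real n * real j)) *\<^sub>R T j) v)"
    using n by (intro sums_sum sums_scaleR_right laplace_sums[OF bnd]
        bounded_linear.sums[OF blinfun.bounded_linear_left]) auto
  moreover have "(\<lambda>j. if j \<in> {0..n} then T j v else 0) sums (\<Sum>j=0..n. T j v)"
    by (rule sums_If_finite_set) simp
  ultimately have "(\<lambda>j. (\<Sum>i\<le>d. a i *\<^sub>R (exp (- (real (i + 1) / real n * real j)) *\<^sub>R T j) v)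
        - s *\<^sub>R (if j \<in> {0..n} then T j v else 0)) sums
      ((\<Sum>i\<le>d. a i *\<^sub>R (\<Sum>j. exp (- (real (i + 1) / real n * real j)) *\<^sub>R T j) v)
        - s *\<^sub>R (\<Sum>j=0..n. T j v))"
    by (intro sums_diff sums_scaleR_right)
  moreover have "(\<Sum>i\<le>d. a i *\<^sub>R (exp (- (real (i + 1) / real n * real j)) *\<^sub>R T j) v)
        - s *\<^sub>R (if j \<in> {0..n} then T j v else 0)
      = (x j * ((\<Sum>i\<le>d. a i * x j ^ i) - s * cutoff (x j))) *\<^sub>R T j v" for j
  proof -
    have "exp (- (real (i + 1) / real n * real j)) = x j * x j ^ i" for i
      by (simp add: x_def exp_of_nat_mult[symmetric] mult_exp_exp add_divide_distrib algebra_simps)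
    then have "(\<Sum>i\<le>d. a i *\<^sub>R (exp (- (real (i + 1) / real n * real j)) *\<^sub>R T j) v)
        = (x j * (\<Sum>i\<le>d. a i * x j ^ i)) *\<^sub>R T j v"
      by (simp add: blinfun.scaleR_left sum_distrib_left scaleR_sum_left mult_ac)
    \<comment> \<open>The condition \<open>x j \<ge> exp (-1)\<close> means
      \<open>j \<le> n\<close>. The last term \<open>j = n\<close> sits exactly at the jump and is
      counted because the cutoff includes it.\<close>
    moreover have "(if j \<in> {0..n} then T j v else 0) = (x j * cutoff (x j)) *\<^sub>R T j v"
      using n by (auto simp: x_def cutoff_def)
    ultimately show ?thesis
      by (simp add: right_diff_distrib scaleR_diff_left mult_ac)
  qed
  ultimately show "(\<lambda>j. (x j * ((\<Sum>i\<le>d. a i * x j ^ i) - s * cutoff (x j))) *\<^sub>R T j v) sums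
      ((\<Sum>i\<le>d. a i *\<^sub>R (\<Sum>j. exp (- (real (i + 1) / real n * real j)) *\<^sub>R T j) v)
        - s *\<^sub>R (\<Sum>j=0..n. T j v))"
    by simp
  show "nonneg ((x j * ((\<Sum>i\<le>d. a i * x j ^ i) - s * cutoff (x j))) *\<^sub>R T j v)" for j
  proof (rule nonneg_scaleR)
    show "0 \<le> x j * ((\<Sum>i\<le>d. a i * x j ^ i) - s * cutoff (x j))"
      using p[of "x j"] by (simp add: x_def)
    show "nonneg (T j v)"
      using pos[of j] v by (simp add: positive_operator_def)
  qed
qed

text \<open>The polynomial bounds \<open>s\<close> times the partial sum by \<open>X n\<close>.
  After scaling by \<open>K n\<close> this bound converges in norm to
  \<open>\<Lambda> *\<^sub>R P v\<close>, where \<open>\<Lambda>\<close> exceeds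
  \<open>s / Gamma (1 + \<beta>)\<close> by at most \<open>\<delta>\<close>.\<close>

lemma karamata_one_sided:
  fixes T :: "nat \<Rightarrow> 'b \<Rightarrow>\<^sub>L 'b"
  assumes bnd: "bounded (range T)" and pos: "\<And>j. positive_operator M rep (T j)"
    and \<beta>: "\<beta> \<ge> 0" and L: "slowly_varying L"
    and asymp: "operator_asymp (at_right 0) (\<lambda>u. \<Sum>j. exp (- (u * real j)) *\<^sub>R T j)
           (\<lambda>u. L (1 / u) * u powr (- \<beta>)) P"
    and s: "s \<in> {1, -1}" and v: "nonneg v" and \<epsilon>: "\<epsilon> > 0"
  shows "eventually (\<lambda>n. AE y in M. s * ((inverse (L (real n)) * real n powr (- \<beta>)) *
           rep (\<Sum>j=0..n. T j v) y - rep (P v) y / Gamma (1 + \<beta>)) \<le> \<epsilon>) sequentially"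
proof -
  define F where "F u = (\<Sum>j. exp (- (u * real j)) *\<^sub>R T j)" for u
  define K where "K n = inverse (L (real n)) * real n powr (- \<beta>)" for n :: nat
  have F_lim: "(\<lambda>n. K n *\<^sub>R F (t / real n) v) \<longlonglongrightarrow> t powr (- \<beta>) *\<^sub>R P v" if "t > 0" for t
  proof -
    have "(\<lambda>n. K n *\<^sub>R F (t / real n)) \<longlonglongrightarrow> t powr (- \<beta>) *\<^sub>R P"
      unfolding K_def F_def by (rule operator_asymp_rescaled[OF L asymp that])
    from blinfun.tendsto[OF this tendsto_const[of v]] show ?thesis
      by (simp add: blinfun.scaleR_left)
  qed
  have "eventually (\<lambda>n. L (real n) > 0) sequentially"
    using slowly_varying_eventually_pos[OF L] filterlim_real_sequentially
    by (rule eventually_compose_filterlim)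
  then have K_pos: "eventually (\<lambda>n. K n > 0) sequentially"
    using eventually_gt_at_top[of 0] by eventually_elim (simp add: K_def)
  \<comment> \<open>Positivity is inherited from the \<open>T j\<close> in the limit. It is needed
    to multiply the upper bound on \<open>\<Lambda>\<close> by \<open>rep (P v) y\<close>.\<close>
  have Pv: "nonneg (P v)"
  proof (rule nonneg_limit)
    show "(\<lambda>n. K n *\<^sub>R F (1 / real n) v) \<longlonglongrightarrow> P v"
      using F_lim[of 1] by simp
    show "eventually (\<lambda>n. nonneg (K n *\<^sub>R F (1 / real n) v)) sequentially"
      using K_pos eventually_gt_at_top[of 0]
    proof eventually_elim
      case (elim n)
      have "(\<lambda>j. (exp (- (1 / real n * real j)) *\<^sub>R T j) v) sums F (1 / real n) v"
        unfolding F_def using elim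
        by (intro bounded_linear.sums[OF blinfun.bounded_linear_left] laplace_sums[OF bnd]) auto
      moreover have "nonneg ((exp (- (1 / real n * real j)) *\<^sub>R T j) v)" for j
        using pos[of j] v unfolding blinfun.scaleR_left positive_operator_def
        by (intro nonneg_scaleR) auto
      ultimately have "nonneg (F (1 / real n) v)" by (rule nonneg_sums)
      with elim show ?case by (intro nonneg_scaleR) auto
    qed
  qed
  \<comment> \<open>Half of \<open>\<epsilon>\<close> pays for the polynomial approximation, half
    for the norm convergence of \<open>K n *\<^sub>R X n\<close>. The summand 1 keeps the
    denominator positive when \<open>P v = 0\<close>.\<close>
  define \<delta> where "\<delta> = \<epsilon> / (2 * (norm (P v) + 1))"
  have \<delta>: "\<delta> > 0" using \<epsilon> by (auto simp: \<delta>_def intro!: divide_pos_pos add_nonneg_pos)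
  obtain a d where p: "\<And>x. x \<in> {0..1} \<Longrightarrow> s * cutoff x \<le> (\<Sum>i\<le>d. a i * x ^ i)"
    and p_int: "(\<Sum>i\<le>d. a i * real (i + 1) powr (- \<beta>)) \<le> s / Gamma (1 + \<beta>) + \<delta>"
    using cutoff_polynomial_approximation[OF \<beta> s \<delta>] by blast
  define \<Lambda> where "\<Lambda> = (\<Sum>i\<le>d. a i * real (i + 1) powr (- \<beta>))"
  define X where "X n = (\<Sum>i\<le>d. a i *\<^sub>R F (real (i + 1) / real n) v)" for n
  have "(\<lambda>n. \<Sum>i\<le>d. a i *\<^sub>R (K n *\<^sub>R F (real (i + 1) / real n) v)) \<longlonglongrightarrow>
      (\<Sum>i\<le>d. a i *\<^sub>R (real (i + 1) powr (- \<beta>) *\<^sub>R P v))"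
    by (intro tendsto_intros F_lim) simp
  then have "(\<lambda>n. K n *\<^sub>R X n) \<longlonglongrightarrow> \<Lambda> *\<^sub>R P v"
    by (simp add: X_def \<Lambda>_def scaleR_sum_right scaleR_sum_left mult.commute)
  then have "eventually (\<lambda>n. dist (K n *\<^sub>R X n) (\<Lambda> *\<^sub>R P v) < \<epsilon> / 2) sequentially"
    using \<epsilon> by (intro tendstoD) auto
  then show ?thesis
    using K_pos eventually_gt_at_top[of 0]
  proof eventually_elim
    case (elim n)
    let ?S = "\<Sum>j=0..n. T j v"
    have "nonneg (X n - s *\<^sub>R ?S)"
      unfolding X_def F_def by (rule partial_sum_le_laplace[OF bnd pos v elim(3) p])
    then show ?case
      using AE_rep_diff[of "X n" "s *\<^sub>R ?S"] rep_scaleR[of s ?S] rep_scaleR[of "K n" "X n"]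
        rep_scaleR[of \<Lambda> "P v"] AE_rep_diff[of "K n *\<^sub>R X n" "\<Lambda> *\<^sub>R P v"]
        AE_abs_rep_le[of "K n *\<^sub>R X n - \<Lambda> *\<^sub>R P v"] Pv AE_abs_rep_le[of "P v"]
    proof eventually_elim
      case (elim y)
      have "s * rep ?S y \<le> rep (X n) y" using elim by simp
      then have "s * (K n * rep ?S y) \<le> K n * rep (X n) y"
        using mult_left_mono[of "s * rep ?S y" "rep (X n) y" "K n"] \<open>K n > 0\<close> by (simp add: mult_ac)
      also have "\<dots> \<le> \<Lambda> * rep (P v) y + \<epsilon> / 2"
        using elim \<open>dist _ _ < _\<close> by (simp add: dist_norm)
      also have "\<Lambda> * rep (P v) y \<le> (s / Gamma (1 + \<beta>) + \<delta>) * rep (P v) y"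
        using p_int elim by (intro mult_right_mono) (auto simp: \<Lambda>_def)
      also have "\<delta> * rep (P v) y \<le> \<delta> * (norm (P v) + 1)"
        using \<delta> elim by (intro mult_left_mono) auto
      then have "(s / Gamma (1 + \<beta>) + \<delta>) * rep (P v) y \<le> s / Gamma (1 + \<beta>) * rep (P v) y + \<delta> * (norm (P v) + 1)"
        by (simp add: distrib_right)
      also have "\<delta> * (norm (P v) + 1) = \<epsilon> / 2"
        using add_nonneg_pos[OF norm_ge_zero[of "P v"] zero_less_one] by (simp add: \<delta>_def field_simps)
      finally show ?case
        by (simp add: K_def right_diff_distrib)
    qed
  qed
qed

text \<open>The two signs of \<open>s\<close> together bound the absolute value. The tolerance is
  first divided by \<open>Gamma (1 + \<beta>)\<close>, since the estimate is then multiplied by that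
  constant.\<close>

lemma karamata_nonneg:
  fixes T :: "nat \<Rightarrow> 'b \<Rightarrow>\<^sub>L 'b"
  assumes bnd: "bounded (range T)" and pos: "\<And>j. positive_operator M rep (T j)"
    and \<beta>: "\<beta> \<ge> 0" and L: "slowly_varying L"
    and asymp: "operator_asymp (at_right 0) (\<lambda>u. \<Sum>j. exp (- (u * real j)) *\<^sub>R T j)
           (\<lambda>u. L (1 / u) * u powr (- \<beta>)) P"
    and v: "nonneg v" and \<epsilon>: "\<epsilon> > 0"
  shows "eventually (\<lambda>n. AE y in M. \<bar>Gamma (1 + \<beta>) * inverse (L (real n)) * real n powr (- \<beta>) *
           (\<Sum>j=0..n. rep (T j v) y) - rep (P v) y\<bar> \<le> \<epsilon>) sequentially"
proof -
  have G: "Gamma (1 + \<beta>) > 0" using \<beta> by (intro Gamma_real_pos) auto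
  then have "\<epsilon> / Gamma (1 + \<beta>) > 0" using \<epsilon> by simp
  note one_sided = karamata_one_sided[OF bnd pos \<beta> L asymp _ v this]
  have "1 \<in> {1, -1::real}" "-1 \<in> {1, -1::real}" by auto
  from one_sided[OF this(1)] one_sided[OF this(2)] show ?thesis
  proof eventually_elim
    case (elim n)
    show ?case
      using elim AE_rep_sum[of "{0..n}" "\<lambda>j. T j v", simplified]
    proof eventually_elim
      case (elim y)
      define D where "D = inverse (L (real n)) * real n powr (- \<beta>) * (\<Sum>j=0..n. rep (T j v) y)
          - rep (P v) y / Gamma (1 + \<beta>)"
      have "\<bar>D\<bar> \<le> \<epsilon> / Gamma (1 + \<beta>)"
        using elim by (auto simp: D_def abs_le_iff)
      then have "\<bar>Gamma (1 + \<beta>) * D\<bar> \<le> \<epsilon>"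
        using G by (simp add: abs_mult field_simps)
      then show ?case using G by (simp add: D_def right_diff_distrib mult_ac)
    qed
  qed
qed

text \<open>The space need not be closed under positive parts. Instead the constant
  \<open>norm v\<close>, which dominates \<open>v\<close> almost everywhere, is added and
  subtracted.\<close>

lemma nonneg_decomposition:
  obtains w1 w2 where "nonneg w1" "nonneg w2" "v = w1 - w2"
proof -
  obtain e where e: "AE y in M. rep e y = norm v"
    using constants by blast
  show thesis
  proof (rule that[of "v + e" e])
    show "nonneg (v + e)"
      using e rep_add[of v e] AE_abs_rep_le[of v] by eventually_elim linarith
    show "nonneg e"
      using e by eventually_elim simp
  qed simp
qed

lemma karamata:
  fixes T :: "nat \<Rightarrow> 'b \<Rightarrow>\<^sub>L 'b"
  assumes bnd: "bounded (range T)" and pos: "\<And>j. positive_operator M rep (T j)"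
    and \<beta>: "\<beta> \<ge> 0" and L: "slowly_varying L"
    and asymp: "operator_asymp (at_right 0) (\<lambda>u. \<Sum>j. exp (- (u * real j)) *\<^sub>R T j)
           (\<lambda>u. L (1 / u) * u powr (- \<beta>)) P"
    and \<epsilon>: "\<epsilon> > 0"
  shows "eventually (\<lambda>n. AE y in M. \<bar>Gamma (1 + \<beta>) * inverse (L (real n)) * real n powr (- \<beta>) *
           (\<Sum>j=0..n. rep (T j v) y) - rep (P v) y\<bar> \<le> \<epsilon>) sequentially"
proof -
  obtain w1 w2 where w: "nonneg w1" "nonneg w2" and v: "v = w1 - w2"
    by (rule nonneg_decomposition)
  have \<epsilon>2: "\<epsilon> / 2 > 0" using \<epsilon> by simp
  \<comment> \<open>Since \<open>rep\<close> is linear only modulo null sets, the exceptional sets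
    of all \<open>j\<close> are united once, independently of \<open>n\<close>.\<close>
  have T_diff: "AE y in M. \<forall>j. rep (T j v) y = rep (T j w1) y - rep (T j w2) y"
    unfolding AE_all_countable v blinfun.diff_right by (intro allI AE_rep_diff)
  show ?thesis
    using karamata_nonneg[OF bnd pos \<beta> L asymp w(1) \<epsilon>2] karamata_nonneg[OF bnd pos \<beta> L asymp w(2) \<epsilon>2]
  proof eventually_elim
    case (elim n)
    show ?case
      using elim T_diff AE_rep_diff[of "P w1" "P w2"]
    proof eventually_elim
      case (elim y)
      have "rep (P v) y = rep (P w1) y - rep (P w2) y"
        using elim by (simp add: v blinfun.diff_right)
      moreover have "(\<Sum>j=0..n. rep (T j v) y) = (\<Sum>j=0..n. rep (T j w1) y) - (\<Sum>j=0..n. rep (T j w2) y)"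
        using elim by (simp add: sum_subtractf)
      ultimately show ?case
        using elim(1,2) by (simp only: right_diff_distrib)
    qed
  qed
qed

end

section \<open>Convergence in the essential supremum norm\<close>

lemma (in prob_space) Linf_norm_tendsto_0I:
  fixes f :: "nat \<Rightarrow> 'a \<Rightarrow> real"
  assumes [measurable]: "\<And>n. f n \<in> borel_measurable M"
    and "\<And>\<epsilon>. \<epsilon> > 0 \<Longrightarrow> eventually (\<lambda>n. AE y in M. \<bar>f n y\<bar> \<le> \<epsilon>) sequentially"
  shows "(\<lambda>n. Linf_norm M (f n)) \<longlonglongrightarrow> 0"
proof (rule order_tendstoI)
  fix c :: ereal assume "c < 0"
  have "0 \<le> Linf_norm M (f n)" for n
  proof -
    \<comment> \<open>On a null space the essential supremum would be minus infinity; total mass 1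
      gives the lower bound 0.\<close>
    have "esssup M (\<lambda>_. 0 :: ereal) \<le> Linf_norm M (f n)"
      unfolding Linf_norm_def by (rule esssup_mono) auto
    then show ?thesis by (simp add: esssup_const emeasure_space_1)
  qed
  with \<open>c < 0\<close> show "eventually (\<lambda>n. c < Linf_norm M (f n)) sequentially"
    by (auto intro!: always_eventually dest: less_le_trans)
next
  fix c :: ereal assume "0 < c"
  then obtain \<epsilon> where \<epsilon>: "0 < ereal \<epsilon>" "ereal \<epsilon> < c"
    using ereal_dense2 by blast
  then have "eventually (\<lambda>n. AE y in M. \<bar>f n y\<bar> \<le> \<epsilon>) sequentially"
    using assms(2) by simp
  then show "eventually (\<lambda>n. Linf_norm M (f n) < c) sequentially"
  proof eventually_elim
    case (elim n)
    have "Linf_norm M (f n) \<le> ereal \<epsilon>"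
      unfolding Linf_norm_def using elim by (intro esssup_I) auto
    with \<epsilon>(2) show ?case by (rule le_less_trans[rotated])
  qed
qed

theorem lemma3p5:
  fixes M :: "'a measure"
    and rep :: "'b::banach \<Rightarrow> 'a \<Rightarrow> real"
    and T :: "nat \<Rightarrow> 'b \<Rightarrow>\<^sub>L 'b"
    and P :: "'b \<Rightarrow>\<^sub>L 'b"
    and L :: "real \<Rightarrow> real"
    and \<beta> :: real
  assumes "Linf_banach_space M rep"
    and "bounded (range T)"
    and "\<And>j. positive_operator M rep (T j)"
    and "\<beta> \<ge> 0"
    and "slowly_varying L"
    and "operator_asymp (at_right 0) (\<lambda>u. \<Sum>j. exp (- (u * real j)) *\<^sub>R T j)
           (\<lambda>u. L (1 / u) * u powr (- \<beta>)) P"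
  shows "\<forall>v. (\<lambda>n. Linf_norm M (\<lambda>y.
            Gamma (1 + \<beta>) * inverse (L (real n)) * real n powr (- \<beta>) *
              (\<Sum>j=0..n. rep (blinfun_apply (T j) v) y)
            - rep (blinfun_apply P v) y)) \<longlonglongrightarrow> 0"
proof
  interpret Linf_banach_space M rep by fact
  note rep_measurable [measurable]
  show "(\<lambda>n. Linf_norm M (\<lambda>y.
            Gamma (1 + \<beta>) * inverse (L (real n)) * real n powr (- \<beta>) *
              (\<Sum>j=0..n. rep (blinfun_apply (T j) v) y)
            - rep (blinfun_apply P v) y)) \<longlonglongrightarrow> 0" for v
    using karamata[OF assms(2-6)] by (intro Linf_norm_tendsto_0I) auto
qed

end
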